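(* In the setting described in the context, let $a_p=\{a_p^{q,i}\}$, $q\in\{0,\dots,N-1\}$, $i\in Y$, be a policy, and let $a_{p+1}=\{a_{p+1}^{q,i}\}$ be the new policy resulting from $a_p$ by the policy improvement step. Then $a_{p+1}$ is an improvement on $a_p$ in the sense that the corresponding approximations to the value functions satisfy $$v_{a_{p+1}h}^{q\Delta t}\le v_{a_ph}^{q\Delta t}\qquad\text{(pointwise on } X\text{) for all } q\in\{0,\dots,N\}.$$
   Context: Data. $X=\mathbb{R}^n$, $U\subseteq\mathbb{R}^m$, $W\subseteq\mathbb{R}^r$. The dynamics are $\dot x=f(x)+g(x)a+h(x)b$ with controls $a\in U$, $b\in W$; $\gamma$ is a constant; $\phi$ is the initial datum. The horizon $T$ is divided into $N$ equal steps of length $\Delta t$, $T=N\Delta t$. For a control value $a\in U$ put $$H_a(x,\pi)=\max_{b}\Big\{\pi\big(f(x)+g(x)a+h(x)b\big)+\tfrac12x^2+\tfrac12a^2-\tfrac{\gamma^2}{2}b^2\Big\}.$$ Finite elements and test functions. $Y=\{1,\dots,I\}$ and $Z=\{1,\dots,J\}$ are index sets, with two sets of discretisation points $(\hat x_i)_{i\in Y}$ and $(\hat x_j)_{j\in Z}$ in $X$. The finite elements are $w_i(x)=-\frac c2\|x-\hat x_i\|_2^2$, $i\in Y$, for a fixed Hessian $c$. The test functions are $z_j(x)=0$ if $x=\hat x_j$ and $z_j(x)=-\infty$ otherwise, $j\in Z$. The max-plus scalar product is $\langle w_i|z_j\rangle=\sup_{x\in X}(w_i(x)+z_j(x))$,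 so here $\langle w_i|z_j\rangle=w_i(\hat x_j)$. For $j\in Z$, $\mu(j)\in Y$ is the index of the cell, in the Voronoi tessellation of $X$ centred on the points $(\hat x_i)_{i\in Y}$, that contains $\hat x_j$. Policies and values. A policy is a set of constants $\{a^{q,i}\}$ in $U$, $q\in\{0,\dots,N-1\}$, $i\in Y$, where $a^{q,i}$ is the control value applied at time step $q$ throughout Voronoi cell $i$. For $a\in U$ put $$\tilde T_{jka}=w_k(\hat x_j)+\Delta t\,H_a\Big(\hat x_j,\tfrac{\partial w_k}{\partial x}\big|_{\hat x_j}\Big).$$ For a policy $a_p$ the coefficients are defined by $\lambda_{p,i}^{0}=\inf_{x\in X}(-w_i(x)+\phi(x))$ and $$\lambda_{p,i}^{(q+1)\Delta t}=\inf_{j\in Z}\Big(-\langle w_i|z_j\rangle+\sup_{k\in Y}\big(\lambda_{p,k}^{q\Delta t}+\tilde T_{j k a_p^{q,\mu(j)}}\big)\Big),\qquad q=0,\dots,N-1,$$ and the approximation (by the max-plus finite element method) to the value function of the optimal control problem with fixed policy $a_p$ is $v_{a_ph}^{q\Delta t}(x)=\sup_{i\in Y}\big(w_i(x)+\lambda_{p,i}^{q\Delta t}\big)$. Policy improvement step. For each $i\in Y$ and $q\in\{0,\dots,N-1\}$ let $\bar j=\bar j(i,q)\in Z$ achieve the infimum over $j$ in the formula for $\lambda_{p,i}^{(q+1)\Delta t}$, and let $\bar k=\bar k(i,q)\in Y$ achieve the supremum over $k$ in that formula with $j=\bar j$. Let $\bar a=\arg\min_{a\in U}\tilde T_{\bar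 j\bar k a}$ subject to the constraints $\lambda_{p,\bar k}^{q\Delta t}+\tilde T_{\bar j\bar k a}\ge\lambda_{p,k}^{q\Delta t}+\tilde T_{\bar j k a}$ for all $k\in Y$, and set $a_{p+1}^{q,\mu(\bar j)}:=\bar a$. For each $q$, in every cell whose index $\mu^*$ is different from $\mu(\bar j(i,q))$ for all $i\in Y$, the policy is left unchanged: $a_{p+1}^{q,\mu^*}=a_p^{q,\mu^*}$. *)

theory Defs
  imports "HOL-Analysis.Analysis"
begin

text \<open>
  Problem data and discretisation: states in \<open>\<real>\<^sup>n\<close>, controls
  \<open>a \<in> ctrlU \<subseteq> \<real>\<^sup>m\<close> and \<open>b \<in> ctrlW \<subseteq> \<real>\<^sup>r\<close>.  The point families \<open>xhat\<close>
  (centres of the finite elements) and \<open>zhat\<close> (supports of the test functions) are only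
  relevant on \<open>{1..numI}\<close> and \<open>{1..numJ}\<close> respectively.  The Voronoi index map
  \<open>mu\<close> is part of the data because a point on a common face of several cells does not
  determine its cell.
\<close>

record ('n::finite, 'm::finite, 'r::finite) fem_data =
  drift :: "real^'n \<Rightarrow> real^'n"
  gmat :: "real^'n \<Rightarrow> real^'m^'n"
  hmat :: "real^'n \<Rightarrow> real^'r^'n"
  ctrlU :: "(real^'m) set"
  ctrlW :: "(real^'r) set"
  gamma :: real
  phi :: "real^'n \<Rightarrow> real"
  horizon :: real
  numN :: nat
  hess :: real
  numI :: nat
  numJ :: nat
  xhat :: "nat \<Rightarrow> real^'n"
  zhat :: "nat \<Rightarrow> real^'n"
  mu :: "nat \<Rightarrow> nat"

definition Y :: "('n::finite, 'm::finite, 'r::finite) fem_data \<Rightarrow> nat set" where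
  "Y P = {1..numI P}"

definition Z :: "('n::finite, 'm::finite, 'r::finite) fem_data \<Rightarrow> nat set" where
  "Z P = {1..numJ P}"

definition dt :: "('n::finite, 'm::finite, 'r::finite) fem_data \<Rightarrow> real" where
  "dt P = horizon P / real (numN P)"

definition voronoi_cell ::
    "('n::finite, 'm::finite, 'r::finite) fem_data \<Rightarrow> nat \<Rightarrow> (real^'n) set" where
  "voronoi_cell P i = {x. \<forall>k\<in>Y P. dist x (xhat P i) \<le> dist x (xhat P k)}"

definition fem_setting :: "('n::finite, 'm::finite, 'r::finite) fem_data \<Rightarrow> bool" where
  "fem_setting P \<longleftrightarrow>
     horizon P > 0 \<and> numN P \<ge> 1 \<and>
     (\<forall>j\<in>Z P. mu P j \<in> Y P \<and> zhat P j \<in> voronoi_cell P (mu P j))"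

text \<open>
  The maximum over \<open>b\<close> is the supremum in the extended reals; the two coincide whenever
  the maximum is attained.
\<close>

definition Ham ::
    "('n::finite, 'm::finite, 'r::finite) fem_data \<Rightarrow> real^'m \<Rightarrow> real^'n \<Rightarrow> real^'n \<Rightarrow> ereal" where
  "Ham P a x \<pi> = (SUP b\<in>ctrlW P. ereal
     (\<pi> \<bullet> (drift P x + gmat P x *v a + hmat P x *v b)
        + 1/2 * (norm x)\<^sup>2 + 1/2 * (norm a)\<^sup>2 - (gamma P)\<^sup>2 / 2 * (norm b)\<^sup>2))"

definition grad :: "('a::real_inner \<Rightarrow> real) \<Rightarrow> 'a \<Rightarrow> 'a" where
  "grad u x = (THE D. GDERIV u x :> D)"

definition w :: "('n::finite, 'm::finite, 'r::finite) fem_data \<Rightarrow> nat \<Rightarrow> real^'n \<Rightarrow> real" where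
  "w P i x = - (hess P / 2) * (norm (x - xhat P i))\<^sup>2"

definition z :: "('n::finite, 'm::finite, 'r::finite) fem_data \<Rightarrow> nat \<Rightarrow> real^'n \<Rightarrow> ereal" where
  "z P j x = (if x = zhat P j then 0 else - \<infinity>)"

definition maxplus_inner :: "('a \<Rightarrow> real) \<Rightarrow> ('a \<Rightarrow> ereal) \<Rightarrow> ereal" where
  "maxplus_inner u v = (SUP x. ereal (u x) + v x)"

lemma grad_w: "grad (w P k) x = - hess P *\<^sub>R (x - xhat P k)"
proof -
  have 1: "GDERIV (w P k) x :> (- hess P *\<^sub>R (x - xhat P k))"
    unfolding gderiv_def w_def[abs_def] power2_norm_eq_inner
    by (auto intro!: derivative_eq_intros simp: algebra_simps inner_commute)
  show ?thesis unfolding grad_def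
  proof (rule the_equality)
    show "GDERIV (w P k) x :> (- hess P *\<^sub>R (x - xhat P k))" by (rule 1)
    fix D assume "GDERIV (w P k) x :> D"
    then have "(\<lambda>h. h \<bullet> D) = (\<lambda>h. h \<bullet> (- hess P *\<^sub>R (x - xhat P k)))"
      using 1 has_derivative_unique unfolding gderiv_def by blast
    then show "D = - hess P *\<^sub>R (x - xhat P k)"
      by (metis vector_eq_ldot)
  qed
qed

lemma inner_wz: "maxplus_inner (w P i) (z P j) = ereal (w P i (zhat P j))"
  unfolding maxplus_inner_def z_def
  by (rule antisym) (auto intro!: SUP_least SUP_upper2[of "zhat P j"])

definition Ttilde ::
    "('n::finite, 'm::finite, 'r::finite) fem_data \<Rightarrow> nat \<Rightarrow> nat \<Rightarrow> real^'m \<Rightarrow> ereal" where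
  "Ttilde P j k a =
     ereal (w P k (zhat P j)) + ereal (dt P) * Ham P a (zhat P j) (grad (w P k) (zhat P j))"

text \<open>
  \<open>a q i\<close> is the control value used at time step \<open>q\<close> throughout Voronoi cell \<open>i\<close>.
\<close>

definition policy ::
    "('n::finite, 'm::finite, 'r::finite) fem_data \<Rightarrow> (nat \<Rightarrow> nat \<Rightarrow> real^'m) \<Rightarrow> bool" where
  "policy P a \<longleftrightarrow> (\<forall>q<numN P. \<forall>i\<in>Y P. a q i \<in> ctrlU P)"

text \<open>
  \<open>lam P a q i\<close> and \<open>vapprox P a q\<close> are the quantities at time \<open>q \<cdot> dt P\<close>.
  Coefficients are extended reals, as the infimum defining the initial ones may
  be \<open>-\<infinity>\<close>.
\<close>

primrec lam ::
    "('n::finite, 'm::finite, 'r::finite) fem_data \<Rightarrow> (nat \<Rightarrow> nat \<Rightarrow> real^'m)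
       \<Rightarrow> nat \<Rightarrow> nat \<Rightarrow> ereal" where
  "lam P a 0 = (\<lambda>i. INF x. ereal (- w P i x + phi P x))"
| "lam P a (Suc q) = (\<lambda>i. INF j\<in>Z P. - maxplus_inner (w P i) (z P j)
      + (SUP k\<in>Y P. lam P a q k + Ttilde P j k (a q (mu P j))))"

definition vapprox ::
    "('n::finite, 'm::finite, 'r::finite) fem_data \<Rightarrow> (nat \<Rightarrow> nat \<Rightarrow> real^'m)
       \<Rightarrow> nat \<Rightarrow> real^'n \<Rightarrow> ereal" where
  "vapprox P a q x = (SUP i\<in>Y P. ereal (w P i x) + lam P a q i)"

text \<open>
  Policy improvement as a relation between the old policy \<open>a\<close> and the new policy \<open>a'\<close>:
  the extremal indices and the constrained minimiser need not be unique, and any choice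
  is admitted.  All assignments, for every \<open>i\<close> and \<open>q\<close>, hold for the resulting policy.
\<close>

definition policy_improvement ::
    "('n::finite, 'm::finite, 'r::finite) fem_data \<Rightarrow> (nat \<Rightarrow> nat \<Rightarrow> real^'m)
       \<Rightarrow> (nat \<Rightarrow> nat \<Rightarrow> real^'m) \<Rightarrow> bool" where
  "policy_improvement P a a' \<longleftrightarrow>
     (\<exists>(jbar :: nat \<Rightarrow> nat \<Rightarrow> nat) (kbar :: nat \<Rightarrow> nat \<Rightarrow> nat) (abar :: nat \<Rightarrow> nat \<Rightarrow> real^'m).
       \<forall>q<numN P.
         (\<forall>i\<in>Y P.
            is_arg_min
              (\<lambda>j. - maxplus_inner (w P i) (z P j)
                 + (SUP k\<in>Y P. lam P a q k + Ttilde P j k (a q (mu P j))))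
              (\<lambda>j. j \<in> Z P) (jbar i q) \<and>
            is_arg_max
              (\<lambda>k. lam P a q k + Ttilde P (jbar i q) k (a q (mu P (jbar i q))))
              (\<lambda>k. k \<in> Y P) (kbar i q) \<and>
            is_arg_min
              (\<lambda>\<alpha>. Ttilde P (jbar i q) (kbar i q) \<alpha>)
              (\<lambda>\<alpha>. \<alpha> \<in> ctrlU P \<and>
                 (\<forall>k\<in>Y P. lam P a q (kbar i q) + Ttilde P (jbar i q) (kbar i q) \<alpha>
                            \<ge> lam P a q k + Ttilde P (jbar i q) k \<alpha>))
              (abar i q) \<and>
            a' q (mu P (jbar i q)) = abar i q) \<and>
         (\<forall>l\<in>Y P. (\<forall>i\<in>Y P. l \<noteq> mu P (jbar i q)) \<longrightarrow> a' q l = a q l))"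

end

theory Submission
  imports Defs
begin

text \<open>
  Induction on the time step, comparing the coefficients \<open>lam\<close>.  Bound the infimum for the new
  policy by its value at the index \<open>j\<close> that is minimal for the old one.  By the constraint on the
  new control, the supremum over \<open>k\<close> at this \<open>j\<close> is still attained at the old maximiser; there the
  new control does no worse than the old one, which satisfies the constraint itself.
\<close>

lemma INF_eq_is_arg_min:
  fixes f :: "'a \<Rightarrow> 'b::complete_linorder"
  assumes "is_arg_min f (\<lambda>x. x \<in> A) x"
  shows "(INF y\<in>A. f y) = f x"
  using assms by (intro antisym INF_greatest INF_lower) (auto simp: is_arg_min_def not_less)

lemma lam_policy_improvement_le:
  assumes "fem_setting P" and "policy P a" and "policy_improvement P a a'"
    and "q \<le> numN P" and "i \<in> Y P"
  shows "lam P a' q i \<le> lam P a q i"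
  using assms(4,5)
proof (induction q arbitrary: i)
  case 0
  \<comment> \<open>The initial coefficients do not involve the policy, so both sides
    coincide.\<close>
  show ?case by simp
next
  case (Suc q)
  then have q: "q < numN P" by simp
  let ?F = "\<lambda>c j. - maxplus_inner (w P i) (z P j)
              + (SUP k\<in>Y P. lam P c q k + Ttilde P j k (c q (mu P j)))"
  \<comment> \<open>All assignments hold simultaneously for \<open>a'\<close>, so its value in the
    cell of \<open>j\<close> solves the problem for this very pair \<open>j\<close>,
    \<open>k\<^sub>0\<close>, even if other indices select the same cell.\<close>
  obtain j k\<^sub>0 where
    j: "is_arg_min (?F a) (\<lambda>j. j \<in> Z P) j" and
    k\<^sub>0: "is_arg_max (\<lambda>k. lam P a q k + Ttilde P j k (a q (mu P j))) (\<lambda>k. k \<in> Y P) k\<^sub>0" and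
    a': "is_arg_min (Ttilde P j k\<^sub>0)
          (\<lambda>\<alpha>. \<alpha> \<in> ctrlU P \<and> (\<forall>k\<in>Y P. lam P a q k\<^sub>0 + Ttilde P j k\<^sub>0 \<alpha>
                                        \<ge> lam P a q k + Ttilde P j k \<alpha>)) (a' q (mu P j))"
    using assms(3) unfolding policy_improvement_def
  proof (elim exE, goal_cases)
    case (1 jbar kbar abar)
    note * = bspec[OF conjunct1[OF mp[OF spec[OF 1(2), of q] q]] \<open>i \<in> Y P\<close>]
    show thesis
      by (rule 1(1)[of "jbar i q" "kbar i q"]) (use * in \<open>elim conjE, simp only:\<close>)+
  qed
  have "j \<in> Z P" using j by (simp add: is_arg_min_def)
  have "k\<^sub>0 \<in> Y P" using k\<^sub>0 by (simp add: is_arg_max_def)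
  \<comment> \<open>Feasibility of the old control: its inequality constraint is exactly the
    maximality of \<open>k\<^sub>0\<close>.\<close>
  have "a q (mu P j) \<in> ctrlU P"
    using assms(1,2) q \<open>j \<in> Z P\<close> by (simp add: fem_setting_def policy_def)
  moreover have "\<forall>k\<in>Y P. lam P a q k + Ttilde P j k (a q (mu P j))
                    \<le> lam P a q k\<^sub>0 + Ttilde P j k\<^sub>0 (a q (mu P j))"
    using k\<^sub>0 by (auto simp: is_arg_max_def not_less)
  ultimately have le: "Ttilde P j k\<^sub>0 (a' q (mu P j)) \<le> Ttilde P j k\<^sub>0 (a q (mu P j))"
    using a' by (auto simp: is_arg_min_def not_less)
  \<comment> \<open>The constraint is phrased with the old coefficients, so the induction hypothesis
    must come first. Addition in \<open>ereal\<close> is monotone even at infinite values.\<close>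
  have "lam P a' q k + Ttilde P j k (a' q (mu P j))
          \<le> (SUP k\<in>Y P. lam P a q k + Ttilde P j k (a q (mu P j)))" if "k \<in> Y P" for k
  proof -
    have "lam P a' q k + Ttilde P j k (a' q (mu P j))
            \<le> lam P a q k + Ttilde P j k (a' q (mu P j))"
      using Suc.IH q that by (intro add_right_mono) simp
    also have "\<dots> \<le> lam P a q k\<^sub>0 + Ttilde P j k\<^sub>0 (a' q (mu P j))"
      using a' that by (simp add: is_arg_min_def)
    also have "\<dots> \<le> lam P a q k\<^sub>0 + Ttilde P j k\<^sub>0 (a q (mu P j))"
      using le by (rule add_left_mono)
    also have "\<dots> \<le> (SUP k\<in>Y P. lam P a q k + Ttilde P j k (a q (mu P j)))"
      using \<open>k\<^sub>0 \<in> Y P\<close> by (rule SUP_upper)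
    finally show ?thesis .
  qed
  then have "?F a' j \<le> ?F a j"
    by (intro add_left_mono SUP_least)
  \<comment> \<open>\<open>j\<close> need not be minimal for \<open>a'\<close>; an upper bound
    suffices there.\<close>
  moreover have "lam P a' (Suc q) i \<le> ?F a' j"
    unfolding lam.simps using \<open>j \<in> Z P\<close> by (rule INF_lower)
  moreover have "lam P a (Suc q) i = ?F a j"
    unfolding lam.simps using j by (rule INF_eq_is_arg_min)
  ultimately show ?case by simp
qed

theorem mainTheorem1:
  fixes P :: "('n::finite, 'm::finite, 'r::finite) fem_data"
    and a a' :: "nat \<Rightarrow> nat \<Rightarrow> real^'m"
  assumes "fem_setting P"
    and "policy P a"
    and "policy_improvement P a a'"
  shows "\<forall>q\<in>{0..numN P}. \<forall>x. vapprox P a' q x \<le> vapprox P a q x"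
  unfolding vapprox_def
\<comment> \<open>The elements \<open>w\<close> do not depend on the policy, so comparing
  coefficients is enough.\<close>
proof (intro ballI allI SUP_subset_mono order_refl add_left_mono)
  fix q x i
  assume "q \<in> {0..numN P}" and "i \<in> Y P"
  then show "lam P a' q i \<le> lam P a q i"
    using lam_policy_improvement_le[OF assms] by simp
qed

end
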